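(* Let $w$ be a finite word over the positive integers. Then $212w\equiv w212$ if and only if the columns of $P(w)$ satisfy both of the following: (a) every column of length $1$ is a singleton $2$-column; (b) every column of length at least $2$ contains both an entry $1$ and an entry $2$.
   Context: $P(v)$ is the RSK insertion tableau of $v$ and $\equiv$ is Knuth equivalence ($v\equiv w$ iff $P(v)=P(w)$). A singleton $2$-column is a column of length $1$ whose single entry is $2$. *)

theory Defs
  imports Main
begin

text \<open>Tableaux are lists of rows in English notation: the top row comes first.
  Row insertion bumps the leftmost entry strictly greater than the inserted one; the bumped
  entry, if any, is the second component of the result.\<close>

fun row_insert :: "nat \<Rightarrow> nat list \<Rightarrow> nat list \<times> nat option" where
  "row_insert x [] = ([x], None)"
| "row_insert x (y # ys) =
     (if x < y then (x # ys, Some y)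
      else (let (zs, b) = row_insert x ys in (y # zs, b)))"

fun tableau_insert :: "nat \<Rightarrow> nat list list \<Rightarrow> nat list list" where
  "tableau_insert x [] = [[x]]"
| "tableau_insert x (r # rs) =
     (case row_insert x r of
        (r', None) \<Rightarrow> r' # rs
      | (r', Some b) \<Rightarrow> r' # tableau_insert b rs)"

text \<open>The letters of a word are inserted from left to right.\<close>

definition insertion_tableau :: "nat list \<Rightarrow> nat list list" where
  "insertion_tableau w = fold tableau_insert w []"

definition knuth_equiv :: "nat list \<Rightarrow> nat list \<Rightarrow> bool" where
  "knuth_equiv v w \<longleftrightarrow> insertion_tableau v = insertion_tableau w"

text \<open>The rows of a tableau are left-justified, so \<^const>\<open>transpose\<close>, which collects the \<open>j\<close>-th
  entries of all rows that have one, yields the list of columns, each read from top to bottom.\<close>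

definition tableau_columns :: "nat list list \<Rightarrow> nat list list" where
  "tableau_columns T = transpose T"

end

theory Submission
  imports Defs
begin

text \<open>Inserting a word into a single row leaves a row and a word of bumped letters, which is
  inserted into the next row; Knuth relations are preserved by this passage from row to row.
  Let the first two rows of \<open>P(w)\<close> be \<open>1\<^sup>a2\<^sup>bz\<close> and \<open>2\<^sup>cy\<close> with all letters of \<open>y\<close>, \<open>z\<close> at least 3.
  Column strictness gives \<open>c \<le> a\<close>, and the column condition means \<open>c = a\<close> and that \<open>y\<close>, \<open>z\<close> are
  empty. The first row of \<open>P(w212)\<close> has \<open>b + 1\<close> letters 2, whereas that of \<open>P(212w)\<close> has at most \<open>b\<close>
  if \<open>c < a\<close>. If \<open>c = a\<close>, then \<open>P(212w)\<close> has rows \<open>1\<^sup>a\<^sup>+\<^sup>12\<^sup>b\<^sup>+\<^sup>1z\<close>, \<open>2\<^sup>a\<^sup>+\<^sup>1y\<close> followed by the remaining rows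
  of \<open>P(w)\<close>, while \<open>w212\<close> pushes out the first two letters of \<open>z\<close>, or the first letter of \<open>y\<close> when
  \<open>z\<close> is empty.\<close>

section \<open>Inserting a word into a single row\<close>

fun feed :: "nat list \<Rightarrow> nat list \<Rightarrow> nat list \<times> nat list" where
  "feed r [] = (r, [])"
| "feed r (x # xs) =
     (case row_insert x r of
        (r', None) \<Rightarrow> feed r' xs
      | (r', Some b) \<Rightarrow> (fst (feed r' xs), b # snd (feed r' xs)))"

definition top_row :: "nat list \<Rightarrow> nat list" where
  "top_row u = fst (feed [] u)"

definition bumped :: "nat list \<Rightarrow> nat list" where
  "bumped u = snd (feed [] u)"

lemma feed_append:
  "feed r (u @ v) = (fst (feed (fst (feed r u)) v), snd (feed r u) @ snd (feed (fst (feed r u)) v))"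
  by (induction u arbitrary: r) (auto split: prod.splits option.splits)

text \<open>A row acts on the rows below only through the letters it bumps, in the order of bumping.
  Insertion can therefore be organised row by row instead of letter by letter.\<close>

lemma fold_tableau_insert_Cons:
  "fold tableau_insert u (r # T) = fst (feed r u) # fold tableau_insert (snd (feed r u)) T"
  by (induction u arbitrary: r T) (auto split: prod.splits option.splits)

lemma insertion_tableau_rec:
  assumes "u \<noteq> []"
  shows "insertion_tableau u = top_row u # insertion_tableau (bumped u)"
  using assms
  by (cases u) (simp_all add: insertion_tableau_def top_row_def bumped_def fold_tableau_insert_Cons)

lemma insertion_tableau_Nil [simp]: "insertion_tableau [] = []"
  by (simp add: insertion_tableau_def)

lemma top_row_Nil [simp]: "top_row [] = []" and bumped_Nil [simp]: "bumped [] = []"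
  by (simp_all add: top_row_def bumped_def)

lemma top_row_append: "top_row (u @ v) = fst (feed (top_row u) v)"
  and bumped_append: "bumped (u @ v) = bumped u @ snd (feed (top_row u) v)"
  by (simp_all add: top_row_def bumped_def feed_append)

lemma set_row_insert:
  "row_insert x r = (r', b) \<Longrightarrow> set r' \<union> set_option b = insert x (set r)"
  by (induction r arbitrary: r' b) (fastforce split: if_splits prod.splits)+

lemma row_insert_bump_gt: "row_insert x r = (r', Some b) \<Longrightarrow> x < b"
  by (induction r arbitrary: r') (auto split: if_splits prod.splits)

lemma sorted_row_insert:
  assumes "sorted r" "row_insert x r = (r', b)"
  shows "sorted r'"
  using assms
proof (induction r arbitrary: r' b)
  case (Cons h t)
  show ?case
  proof (cases "x < h")
    case True
    then show ?thesis using Cons.prems by fastforce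
  next
    case False
    obtain t' b' where t': "row_insert x t = (t', b')" by fastforce
    have "sorted t'" using Cons.IH[OF _ t'] Cons.prems(1) by simp
    moreover have "set t' \<subseteq> insert x (set t)" using set_row_insert[OF t'] by blast
    ultimately show ?thesis using Cons.prems False t' by fastforce
  qed
qed simp

lemma sorted_feed: "sorted r \<Longrightarrow> sorted (fst (feed r u))"
  by (induction u arbitrary: r) (auto split: prod.splits option.splits dest: sorted_row_insert)

lemma sorted_top_row: "sorted (top_row u)"
  by (simp add: top_row_def sorted_feed)

lemma set_feed: "set (fst (feed r u)) \<union> set (snd (feed r u)) = set r \<union> set u"
proof (induction u arbitrary: r)
  case (Cons x u)
  obtain r' b where r': "row_insert x r = (r', b)" by fastforce
  show ?case using set_row_insert[OF r'] Cons[of r'] r' by (auto split: option.splits)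
qed simp

lemma set_top_row: "set (top_row u) \<subseteq> set u" and set_bumped: "set (bumped u) \<subseteq> set u"
  using set_feed[of "[]" u] by (auto simp: top_row_def bumped_def)

text \<open>Every bumped letter exceeds the letter that bumps it, so lower bounds on the letters
  grow by one from each row to the next.\<close>

lemma feed_bumped_gt:
  "\<forall>x\<in>set u. n \<le> x \<Longrightarrow> \<forall>x\<in>set (snd (feed r u)). n < x"
proof (induction u arbitrary: r)
  case (Cons x u)
  obtain r' b where r': "row_insert x r = (r', b)" by fastforce
  show ?case using row_insert_bump_gt[of x r r'] Cons.IH[of r'] Cons.prems r'
    by (auto split: option.splits)
qed simp

lemma bumped_gt: "\<forall>x\<in>set u. n \<le> x \<Longrightarrow> \<forall>x\<in>set (bumped u). n < x"
  unfolding bumped_def by (rule feed_bumped_gt)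

text \<open>The first letter enters the empty row without bumping. This gives the measure for
  inductions over the rows.\<close>

lemma length_bumped: "u \<noteq> [] \<Longrightarrow> length (bumped u) < length u"
proof -
  have "length (snd (feed r v)) \<le> length v" for r v
    by (induction v arbitrary: r) (auto split: prod.splits option.splits simp: le_SucI)
  then show "u \<noteq> [] \<Longrightarrow> length (bumped u) < length u"
    by (cases u) (auto simp: bumped_def less_Suc_eq_le)
qed

lemma row_insert_append:
  "\<forall>y\<in>set p. y \<le> x \<Longrightarrow> row_insert x (p @ r) = (p @ fst (row_insert x r), snd (row_insert x r))"
  by (induction p) (auto split: prod.splits)

lemma feed_prefix:
  "\<forall>y\<in>set p. \<forall>x\<in>set u. y \<le> x \<Longrightarrow> feed (p @ r) u = (p @ fst (feed r u), snd (feed r u))"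
  by (induction u arbitrary: r) (auto simp: row_insert_append split: prod.splits option.splits)

subsection \<open>Consecutive rows\<close>

text \<open>Column strictness for two left-justified consecutive rows, including that the lower row
  is not the longer one.\<close>

fun dominates :: "nat list \<Rightarrow> nat list \<Rightarrow> bool" where
  "dominates X [] = True"
| "dominates [] (y # Y) = False"
| "dominates (x # X) (y # Y) = (x < y \<and> dominates X Y)"

lemma dominates_iff:
  "dominates X Y \<longleftrightarrow> length Y \<le> length X \<and> (\<forall>i < length Y. X ! i < Y ! i)"
  by (induction X Y rule: dominates.induct) (auto simp: nth_Cons' less_Suc_eq_0_disj All_less_Suc2)

lemma dominates_row_insert:
  assumes "dominates X Y" "row_insert x X = (X', b)"
  shows "dominates X' Y"
  using assms
proof (induction X Y arbitrary: X' b rule: dominates.induct)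
  case (3 h X y Y)
  then show ?case by (cases "row_insert x X") (auto split: if_splits)
qed auto

text \<open>The entry of \<open>Y\<close> below the old place of \<open>b\<close>, if present,
  exceeds \<open>b\<close>, so \<open>b\<close> lands in the same column or further left. There the
  entry above is \<open>x\<close> or a letter that \<open>x\<close> passed over, and both are
  smaller than \<open>b\<close>.\<close>

lemma dominates_bump:
  assumes "dominates X Y" "row_insert x X = (X', Some b)"
  shows "dominates X' (fst (row_insert b Y))"
  using assms
proof (induction X Y arbitrary: X' rule: dominates.induct)
  case (1 X)
  then show ?case
    by (cases X) (auto split: if_splits prod.splits dest: row_insert_bump_gt)
next
  case (3 h X y Y)
  obtain X1 c where X1: "row_insert x X = (X1, c)" by fastforce
  show ?case
    using 3 X1 row_insert_bump_gt[of x X X1 b] dominates_row_insert[of X Y x X1 c]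
    by (auto split: if_splits prod.splits)
qed auto

lemma dominates_top_row: "dominates (top_row w) (top_row (bumped w))"
proof (induction w rule: rev_induct)
  case (snoc x w)
  obtain r b where r: "row_insert x (top_row w) = (r, b)" by fastforce
  show ?case
  proof (cases b)
    case None
    then show ?thesis using r dominates_row_insert[OF snoc r]
      by (simp add: top_row_append bumped_append)
  next
    case (Some c)
    then show ?thesis using r dominates_bump[OF snoc, of x r c]
      by (cases "row_insert c (top_row (bumped w))")
         (simp add: top_row_append bumped_append split: option.splits)
  qed
qed simp

text \<open>Each letter of \<open>X\<close> passes over the letters \<open>P\<close> already placed
  and bumps the entry of \<open>Y\<close> in its own column; once \<open>Y\<close> is used up, the
  remaining letters are appended.\<close>

lemma feed_dominates:
  assumes "sorted X" "dominates X Y" "\<forall>p\<in>set P. \<forall>x\<in>set X. p \<le> x"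
  shows "feed (P @ Y) X = (P @ X, Y)"
  using assms
proof (induction X Y arbitrary: P rule: dominates.induct)
  case (1 X)
  then show ?case
  proof (induction X arbitrary: P)
    case (Cons x X)
    then show ?case using Cons.IH[of "P @ [x]"] row_insert_append[of P x "[]"] by fastforce
  qed simp
next
  case (3 x X y Y)
  have "feed ((P @ [x]) @ Y) X = ((P @ [x]) @ X, Y)"
    using 3 by (intro "3.IH") auto
  then show ?case using 3 by (simp add: row_insert_append)
qed auto

lemma length_rows:
  "r \<in> set (insertion_tableau w) \<Longrightarrow> length r \<le> length (top_row w)"
proof (induction "length w" arbitrary: w rule: less_induct)
  case less
  show ?case
  proof (cases "w = []")
    case False
    have "length (top_row (bumped w)) \<le> length (top_row w)"
      using dominates_top_row by (simp add: dominates_iff)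
    then show ?thesis
      using less.hyps[OF length_bumped[OF False]] less.prems insertion_tableau_rec[OF False]
      by fastforce
  qed (use less in simp)
qed

lemma set_rows: "r \<in> set (insertion_tableau w) \<Longrightarrow> set r \<subseteq> set w"
proof (induction "length w" arbitrary: w rule: less_induct)
  case less
  show ?case
  proof (cases "w = []")
    case False
    then show ?thesis
      using less.hyps[OF length_bumped[OF False]] less.prems insertion_tableau_rec[OF False]
        set_top_row set_bumped by fastforce
  qed (use less in simp)
qed

subsection \<open>Knuth relations\<close>

text \<open>Quantifying over all starting tableaux makes the relation a congruence.\<close>

definition plactic :: "nat list \<Rightarrow> nat list \<Rightarrow> bool" where
  "plactic u v \<longleftrightarrow>
     (\<forall>T. (\<forall>r\<in>set T. sorted r) \<longrightarrow> fold tableau_insert u T = fold tableau_insert v T)"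

lemma plactic_refl: "plactic u u"
  and plactic_sym: "plactic u v \<Longrightarrow> plactic v u"
  and plactic_trans [trans]: "plactic u v \<Longrightarrow> plactic v w \<Longrightarrow> plactic u w"
  by (auto simp: plactic_def)

lemma sorted_tableau_insert:
  "\<forall>r\<in>set T. sorted r \<Longrightarrow> \<forall>r\<in>set (tableau_insert x T). sorted r"
  by (induction x T rule: tableau_insert.induct)
     (auto split: prod.splits option.splits dest: sorted_row_insert[OF _ sym])

lemma sorted_fold_tableau_insert:
  "\<forall>r\<in>set T. sorted r \<Longrightarrow> \<forall>r\<in>set (fold tableau_insert u T). sorted r"
  by (induction u arbitrary: T) (simp, metis fold_simps(2) sorted_tableau_insert)

lemma plactic_append: "plactic u v \<Longrightarrow> plactic (a @ u @ b) (a @ v @ b)"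
  using sorted_fold_tableau_insert by (fastforce simp: plactic_def)

lemma insertion_tableau_plactic: "plactic u v \<Longrightarrow> insertion_tableau u = insertion_tableau v"
  by (simp add: plactic_def insertion_tableau_def)

inductive knuth_step :: "nat list \<Rightarrow> nat list \<Rightarrow> bool" where
  "x < y \<Longrightarrow> y \<le> z \<Longrightarrow> knuth_step [y, x, z] [y, z, x]"
| "x \<le> y \<Longrightarrow> y < z \<Longrightarrow> knuth_step [x, z, y] [z, x, y]"

text \<open>The later, weakly larger letter \<open>z\<close> lands to the right of \<open>y\<close>;
  if it still bumps, \<open>y\<close> has bumped something weakly smaller.\<close>

lemma row_insert_weak:
  assumes "sorted t" "y \<le> z" "row_insert y t = (t1, b)" "row_insert z t1 = (t2, Some d)"
  shows "\<exists>c. b = Some c \<and> c \<le> d"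
  using assms
proof (induction t arbitrary: t1 t2)
  case (Cons h t)
  obtain u1 b1 where u1: "row_insert y t = (u1, b1)" by fastforce
  obtain u2 b2 where u2: "row_insert z t = (u2, b2)" by fastforce
  obtain u3 b3 where u3: "row_insert z u1 = (u3, b3)" by fastforce
  have "h \<le> d" if "b2 = Some d"
    using set_row_insert[OF u2] row_insert_bump_gt[of z t u2 d] u2 that Cons.prems by auto
  then show ?case
    using Cons u1 u2 u3 by (auto split: if_splits)
qed auto

text \<open>The smaller letter \<open>y\<close>, inserted second, meets \<open>z\<close> at the
  latest and so always bumps.\<close>

lemma row_insert_strict:
  assumes "y < z" "row_insert z t = (t1, b)" "row_insert y t1 = (t2, d)"
  shows "\<exists>c. d = Some c \<and> c \<le> z"
  using assms
proof (induction t arbitrary: t1 t2)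
  case (Cons h t)
  obtain u1 b1 where u1: "row_insert z t = (u1, b1)" by fastforce
  obtain u2 b2 where u2: "row_insert y u1 = (u2, b2)" by fastforce
  show ?case using Cons u1 u2 by (auto split: if_splits)
qed auto

text \<open>Bumping can erase the difference between the two words, and it can turn a relation of
  the second kind into one of the first kind read backwards; hence equality and both
  directions.\<close>

definition knuth_close :: "nat list \<Rightarrow> nat list \<Rightarrow> bool" where
  "knuth_close u v \<longleftrightarrow> u = v \<or> knuth_step u v \<or> knuth_step v u"

lemma feed_knuth1:
  assumes "sorted r" "x < y" "y \<le> z"
  shows "fst (feed r [y, x, z]) = fst (feed r [y, z, x]) \<and>
    knuth_close (snd (feed r [y, x, z])) (snd (feed r [y, z, x]))"
  using assms
proof (induction r)
  case Nil
  then show ?case by (simp add: knuth_close_def)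
next
  case (Cons h t)
  obtain ty b where ty: "row_insert y t = (ty, b)" by fastforce
  obtain tyz c where tyz: "row_insert z ty = (tyz, c)" by fastforce
  obtain tz d where tz: "row_insert z t = (tz, d)" by fastforce
  \<comment> \<open>The head \<open>h\<close> decides which letters meet it. In the last case all
    three pass over it, and the induction hypothesis for \<open>t\<close> applies.\<close>
  consider "y < h" | "h \<le> y" "x < h" | "h \<le> x" using Cons.prems by linarith
  then show ?case
  proof cases
    case 1
    have "h \<le> d'" if "d = Some d'" for d'
      using row_insert_bump_gt[of z t tz d'] set_row_insert[OF tz] tz that Cons.prems by auto
    then show ?thesis
      using 1 Cons.prems tz
      by (auto simp: knuth_close_def knuth_step.simps split: option.splits)
  next
    case 2
    have "h < b'" if "b = Some b'" for b'
      using row_insert_bump_gt ty that 2 by fastforce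
    moreover have "\<exists>b'. b = Some b' \<and> b' \<le> c'" if "c = Some c'" for c'
      using row_insert_weak[OF _ _ ty] tyz that Cons.prems by simp
    ultimately show ?thesis
      using Cons.prems 2 ty tyz
      by (auto simp: knuth_close_def knuth_step.simps split: option.splits)
  next
    case 3
    then show ?thesis
      using Cons feed_prefix[of "[h]" "[y, x, z]" t] feed_prefix[of "[h]" "[y, z, x]" t]
      by (simp del: feed.simps)
  qed
qed

lemma feed_knuth2:
  assumes "sorted r" "x \<le> y" "y < z"
  shows "fst (feed r [x, z, y]) = fst (feed r [z, x, y]) \<and>
    knuth_close (snd (feed r [x, z, y])) (snd (feed r [z, x, y]))"
  using assms
proof (induction r)
  case Nil
  then show ?case by (simp add: knuth_close_def)
next
  case (Cons h t)
  obtain tz b where tz: "row_insert z t = (tz, b)" by fastforce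
  obtain tzy c where tzy: "row_insert y tz = (tzy, c)" by fastforce
  consider "z < h" | "h \<le> z" "x < h" | "h \<le> x" using Cons.prems by linarith
  then show ?case
  proof cases
    case 1
    \<comment> \<open>If \<open>t\<close> starts with \<open>k\<close>, the bumped words are
      \<open>h\<close>, \<open>k\<close>, \<open>z\<close> and \<open>h\<close>, \<open>z\<close>,
      \<open>k\<close>, with \<open>z < h\<close> and \<open>h \<le> k\<close>: the first Knuth
      relation, reversed. If \<open>t\<close> is empty, both are \<open>h\<close>,
      \<open>z\<close>.\<close>
    then show ?thesis
      using Cons.prems
      by (cases t) (auto simp: knuth_close_def knuth_step.simps split: option.splits)
  next
    case 2
    obtain c' where c': "c = Some c'" "c' \<le> z"
      using row_insert_strict[OF _ tz tzy] Cons.prems by blast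
    have "h \<le> c'"
      using set_row_insert[OF tz] set_row_insert[OF tzy] c' Cons.prems 2
        row_insert_bump_gt[of y tz tzy c'] tzy by auto
    moreover have "z < b'" if "b = Some b'" for b'
      using row_insert_bump_gt tz that by fastforce
    ultimately show ?thesis
      using Cons.prems 2 tz tzy c'
      by (auto simp: knuth_close_def knuth_step.simps split: option.splits)
  next
    case 3
    then show ?thesis
      using Cons feed_prefix[of "[h]" "[x, z, y]" t] feed_prefix[of "[h]" "[z, x, y]" t]
      by (simp del: feed.simps)
  qed
qed

lemma feed_knuth_step:
  "sorted r \<Longrightarrow> knuth_step u v \<Longrightarrow>
    fst (feed r u) = fst (feed r v) \<and> knuth_close (snd (feed r u)) (snd (feed r v))"
  using feed_knuth1 feed_knuth2 by (fastforce simp only: knuth_step.simps)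

text \<open>Induction over the rows: the first row becomes the same for both words, and the bumped
  words are again equal or related, so the lower rows agree as well.\<close>

lemma plactic_knuth_step:
  assumes "knuth_step u v"
  shows "plactic u v"
proof -
  have "fold tableau_insert u T = fold tableau_insert v T" if "\<forall>r\<in>set T. sorted r" for T
    using that assms
  proof (induction T arbitrary: u v)
    case Nil
    then show ?case by (auto simp: knuth_step.simps)
  next
    case (Cons r T)
    then show ?case using feed_knuth_step[of r u v]
      by (auto simp: fold_tableau_insert_Cons knuth_close_def)
  qed
  then show ?thesis by (simp add: plactic_def)
qed

text \<open>The letter \<open>x\<close> moves left through \<open>ds\<close> by the first Knuth
  relation, each time with a letter larger than \<open>x\<close> standing in front.\<close>

lemma plactic_bump_right:
  assumes "sorted (b # ds)" "x < b"
  shows "plactic (b # ds @ [x]) (b # x # ds)"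
  using assms
proof (induction ds arbitrary: b)
  case (Cons d ds)
  then have "plactic (d # ds @ [x]) (d # x # ds)" by simp
  then have "plactic (b # (d # ds) @ [x]) ([b, d, x] @ ds)"
    using plactic_append[of "d # ds @ [x]" "d # x # ds" "[b]" "[]"] by simp
  also have "plactic ([b, d, x] @ ds) ([b, x, d] @ ds)"
    using plactic_append[of "[b, d, x]" "[b, x, d]" "[]" ds] Cons.prems
    by (simp add: plactic_knuth_step plactic_sym knuth_step.intros)
  finally show ?case by simp
qed (simp add: plactic_refl)

lemma plactic_bump_left:
  assumes "sorted (p @ [x])" "x < b"
  shows "plactic (p @ [b, x]) (b # p @ [x])"
  using assms
proof (induction p)
  case (Cons h p)
  \<comment> \<open>\<open>e\<close> is the letter right after \<open>b\<close> once
    \<open>b\<close> has passed \<open>p\<close>; since \<open>h \<le> e\<close> and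
    \<open>e < b\<close>, it is the witness that lets \<open>b\<close> also pass
    \<open>h\<close>.\<close>
  obtain e q where e: "p @ [x] = e # q" by (cases p) auto
  have "e \<le> x" using Cons.prems e by (cases p) auto
  moreover have "h \<le> e" using Cons.prems e by auto
  ultimately have *: "plactic [h, b, e] [b, h, e]"
    using Cons.prems by (simp add: plactic_knuth_step knuth_step.intros)
  have "plactic (p @ [b, x]) (b # p @ [x])" using Cons by simp
  then have "plactic ((h # p) @ [b, x]) ([h, b, e] @ q)"
    using plactic_append[of "p @ [b, x]" "b # p @ [x]" "[h]" "[]"] e by simp
  also have "plactic ([h, b, e] @ q) ([b, h, e] @ q)"
    using plactic_append[OF *, of "[]" q] by simp
  finally show ?case using e by simp
qed (simp add: plactic_refl)

lemma row_insert_split: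
  "row_insert x r = (r', b) \<Longrightarrow> \<exists>p. (\<forall>y\<in>set p. y \<le> x) \<and>
    (case b of None \<Rightarrow> r = p \<and> r' = p @ [x]
     | Some c \<Rightarrow> x < c \<and> (\<exists>ds. r = p @ c # ds \<and> r' = p @ x # ds))"
proof (induction r arbitrary: r')
  case (Cons h t)
  show ?case
  proof (cases "x < h")
    case True
    then show ?thesis using Cons.prems by (intro exI[of _ "[]"]) auto
  next
    case False
    obtain t' where t': "row_insert x t = (t', b)" "r' = h # t'"
      using Cons.prems False by (auto split: prod.splits)
    obtain p where "\<forall>y\<in>set p. y \<le> x"
      "case b of None \<Rightarrow> t = p \<and> t' = p @ [x]
       | Some c \<Rightarrow> x < c \<and> (\<exists>ds. t = p @ c # ds \<and> t' = p @ x # ds)"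
      using Cons.IH[OF t'(1)] by blast
    then show ?thesis using False t' by (intro exI[of _ "h # p"]) (auto split: option.splits)
  qed
qed auto

text \<open>With the row split at \<open>b\<close>, first \<open>x\<close> moves left until it
  stands next to \<open>b\<close>, then \<open>b\<close> moves left past the letters before
  it.\<close>

lemma plactic_row_insert:
  assumes "sorted r" "row_insert x r = (r', Some b)"
  shows "plactic (r @ [x]) (b # r')"
proof -
  obtain p ds where r: "\<forall>y\<in>set p. y \<le> x" "x < b" "r = p @ b # ds" "r' = p @ x # ds"
    using row_insert_split[OF assms(2)] by auto
  have "plactic (p @ (b # ds @ [x]) @ []) (p @ (b # x # ds) @ [])"
    using assms(1) r by (intro plactic_append plactic_bump_right) (auto simp: sorted_append)
  also have "plactic (p @ (b # x # ds) @ []) ([] @ (b # p @ [x]) @ ds)"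
    using plactic_append[OF plactic_bump_left[of p x b], of "[]" ds] assms(1) r
    by (auto simp: sorted_append)
  finally show ?thesis using r by simp
qed

lemma plactic_feed:
  "sorted r \<Longrightarrow> plactic (r @ u) (snd (feed r u) @ fst (feed r u))"
proof (induction u arbitrary: r)
  case (Cons x u)
  obtain r' b where r': "row_insert x r = (r', b)" by fastforce
  have IH: "plactic (r' @ u) (snd (feed r' u) @ fst (feed r' u))"
    using Cons sorted_row_insert r' by blast
  show ?case
  proof (cases b)
    case None
    then show ?thesis using IH r' row_insert_split[OF r'] by auto
  next
    case (Some c)
    have "plactic (r @ x # u) (c # r' @ u)"
      using plactic_append[OF plactic_row_insert[OF Cons.prems], of x r' c "[]" u] r' Some by simp
    also have "plactic (c # r' @ u) (c # snd (feed r' u) @ fst (feed r' u))"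
      using plactic_append[OF IH, of "[c]" "[]"] by simp
    finally show ?thesis using r' Some by simp
  qed
qed (simp add: plactic_refl)

text \<open>This replaces \<open>w\<close> by a word ending in its sorted first row, which makes
  left multiplication computable row by row.\<close>

lemma plactic_bumped_top_row: "plactic u (bumped u @ top_row u)"
  using plactic_feed[of "[]" u] by (simp add: top_row_def bumped_def)

subsection \<open>Multiplication by 212\<close>

lemma sorted_split_least:
  fixes r :: "nat list"
  assumes "sorted r" "\<forall>x\<in>set r. n \<le> x"
  obtains k s where "r = replicate k n @ s" "sorted s" "\<forall>x\<in>set s. Suc n \<le> x"
proof -
  have "\<exists>k s. r = replicate k n @ s \<and> sorted s \<and> (\<forall>x\<in>set s. Suc n \<le> x)"
    using assms
  proof (induction r)
    case (Cons h t)
    show ?case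
    proof (cases "h = n")
      case True
      have "\<exists>k s. t = replicate k n @ s \<and> sorted s \<and> (\<forall>x\<in>set s. Suc n \<le> x)"
        using Cons.prems by (intro Cons.IH) simp_all
      then obtain k s where "t = replicate k n @ s" "sorted s" "\<forall>x\<in>set s. Suc n \<le> x"
        by blast
      then show ?thesis using True by (intro exI[of _ "Suc k"] exI[of _ s]) simp
    next
      case False
      then have "Suc n \<le> h" using Cons.prems by simp
      then show ?thesis using Cons.prems by (intro exI[of _ 0] exI[of _ "h # t"]) fastforce
    qed
  qed auto
  then show ?thesis using that by blast
qed

lemma insertion_tableau_Cons_least:
  assumes "\<forall>x\<in>set u. n \<le> x"
  shows "insertion_tableau (n # u) = (n # top_row u) # insertion_tableau (bumped u)"
proof -
  have "feed [n] u = (n # top_row u, bumped u)"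
    using feed_prefix[of "[n]" u "[]"] assms by (simp add: top_row_def bumped_def)
  then show ?thesis
    by (simp add: insertion_tableau_def fold_tableau_insert_Cons)
qed

text \<open>Each 1 passes over the ones and replaces the leftmost 2; \<open>i\<close> counts the
  ones already in front.\<close>

lemma feed_replicate_12:
  "feed (replicate i 1 @ replicate n 2 @ s) (replicate n 1) = (replicate (i + n) 1 @ s, replicate n 2)"
proof (induction n arbitrary: i)
  case (Suc n)
  have "row_insert (1::nat) (replicate i 1 @ 2 # replicate n 2 @ s)
      = (replicate (Suc i) 1 @ replicate n 2 @ s, Some 2)"
    by (subst row_insert_append) (auto simp: replicate_app_Cons_same replicate_append_same)
  then show ?case using Suc[of "Suc i"] by simp
qed simp

text \<open>The first 2 replaces the first letter of \<open>z\<close>, the 1 replaces the leftmost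
  2, and the last 2 replaces the next letter of \<open>z\<close>. The forms with \<open>take\<close>
  and \<open>drop\<close> cover a \<open>z\<close> with fewer than two letters, where a 2 is
  appended instead.\<close>

lemma feed_212:
  assumes "\<forall>x\<in>set z. 3 \<le> x"
  shows "feed (replicate a 1 @ replicate b 2 @ z) [2, 1, 2] =
    (replicate (Suc a) 1 @ replicate (Suc b) 2 @ drop 2 z, take 1 z @ [2] @ take 1 (drop 1 z))"
proof -
  have 2: "row_insert 2 (replicate a 1 @ replicate b 2 @ s) =
    (replicate a 1 @ replicate (Suc b) 2 @ tl s, case s of [] \<Rightarrow> None | h # _ \<Rightarrow> Some h)"
    if "\<forall>x\<in>set s. 3 \<le> x" for a b and s :: "nat list"
  proof -
    have "row_insert 2 ((replicate a 1 @ replicate b 2) @ s) =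
      ((replicate a 1 @ replicate b 2) @ fst (row_insert 2 s), snd (row_insert 2 s))"
      by (rule row_insert_append) auto
    then show ?thesis
      using that by (cases s) (auto simp: replicate_app_Cons_same replicate_append_same)
  qed
  have 1: "row_insert 1 (replicate a 1 @ replicate (Suc b) 2 @ s) =
    (replicate (Suc a) 1 @ replicate b 2 @ s, Some 2)" for a b and s :: "nat list"
    by (subst row_insert_append) (auto simp: replicate_app_Cons_same)
  have tl: "\<forall>x\<in>set (tl z). 3 \<le> x" using assms by (cases z) auto
  show ?thesis
    using 2[OF assms, of a b] 1[of a b "tl z"] 2[OF tl, of "Suc a" b]
    by (cases z; cases "tl z") auto
qed

text \<open>Insertion creates no letters. This bounds the number of twos in the first row when
  \<open>c < a\<close>.\<close>

lemma count_list_feed: "count_list (fst (feed r u)) n \<le> count_list r n + count_list u n"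
proof -
  have ins: "count_list (fst (row_insert x r)) n \<le> count_list (x # r) n" for x r
    by (induction r) (auto split: prod.splits)
  show ?thesis
  proof (induction u arbitrary: r)
    case (Cons x u)
    obtain r' b where r': "row_insert x r = (r', b)" by fastforce
    show ?case using Cons[of r'] ins[of x r] r' by (auto split: option.splits if_splits)
  qed simp
qed

section \<open>The column condition in terms of the first two rows\<close>

lemma set_tableau_columns:
  "set (tableau_columns (insertion_tableau w)) =
    (\<lambda>i. map (\<lambda>r. r ! i) (filter (\<lambda>r. i < length r) (insertion_tableau w))) ` {..<length (top_row w)}"
proof -
  have foldr_max: "foldr (\<lambda>xs. max (length xs)) T 0 \<le> n" if "\<forall>r\<in>set T. length r \<le> n"
    for T :: "nat list list" and n
    using that by (induction T) auto
  have len: "length (transpose (insertion_tableau w)) = length (top_row w)"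
  proof (cases "w = []")
    case False
    have "foldr (\<lambda>xs. max (length xs)) (insertion_tableau w) 0 \<le> length (top_row w)"
      using foldr_max length_rows by blast
    moreover have "length (top_row w) \<le> foldr (\<lambda>xs. max (length xs)) (insertion_tableau w) 0"
      using insertion_tableau_rec[OF False] by simp
    ultimately show ?thesis by (simp add: length_transpose)
  qed simp
  have "set xs = (!) xs ` {..<length xs}" for xs :: "nat list list"
    by (auto simp: set_conv_nth)
  then show ?thesis
    by (simp add: tableau_columns_def len nth_transpose cong: image_cong_simp)
qed

text \<open>Entries from the third row on are at least 3 and those of the second at least 2, so a
  long column can have its 1 only in the first row and then its 2 only in the second. The columns of
  length 1 are those beyond the end of \<open>T2\<close>.\<close>

lemma columns_iff:
  fixes w :: "nat list"
  defines "T1 \<equiv> top_row w" and "T2 \<equiv> top_row (bumped w)"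
  assumes pos: "\<forall>x\<in>set w. 0 < x"
  shows "(\<forall>c \<in> set (tableau_columns (insertion_tableau w)).
        (length c = 1 \<longrightarrow> c = [2]) \<and> (2 \<le> length c \<longrightarrow> 1 \<in> set c \<and> 2 \<in> set c)) \<longleftrightarrow>
    T1 = replicate (length T2) 1 @ replicate (length T1 - length T2) 2 \<and>
    T2 = replicate (length T2) 2"
    (is "(\<forall>c\<in>_. ?good c) \<longleftrightarrow> _")
proof -
  define col where
    "col i = map (\<lambda>r. r ! i) (filter (\<lambda>r. i < length r) (insertion_tableau w))" for i
  have le: "length T2 \<le> length T1"
    using dominates_top_row[of w] by (simp add: T1_def T2_def dominates_iff)
  have w1: "\<forall>x\<in>set w. 1 \<le> x" using pos by auto
  have o1: "\<forall>x\<in>set (bumped w). 2 \<le> x" using bumped_gt[OF w1] by auto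
  have o2: "\<forall>x\<in>set (bumped (bumped w)). 3 \<le> x" using bumped_gt[OF o1] by auto
  have T2: "T2 ! i \<ge> 2" if "i < length T2" for i
    using nth_mem[OF that] o1 set_top_row[of "bumped w"] unfolding T2_def by blast
  have long: "?good (col i) \<longleftrightarrow> T1 ! i = 1 \<and> T2 ! i = 2" if i: "i < length T2" for i
  proof -
    define R where "R = insertion_tableau (bumped (bumped w))"
    define ds where "ds = map (\<lambda>r. r ! i) (filter (\<lambda>r. i < length r) R)"
    have "bumped w \<noteq> []" "w \<noteq> []" using i by (auto simp: T2_def)
    then have "insertion_tableau w = T1 # T2 # R"
      by (simp add: insertion_tableau_rec T1_def T2_def R_def)
    then have col: "col i = T1 ! i # T2 ! i # ds"
      using i le by (simp add: col_def ds_def)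
    have "3 \<le> r ! i" if "r \<in> set R" "i < length r" for r
      using set_rows[of r "bumped (bumped w)"] nth_mem[OF that(2)] that(1) o2 unfolding R_def by blast
    then have "\<forall>x\<in>set ds. 3 \<le> x" by (auto simp: ds_def)
    then have "1 \<notin> set ds" "2 \<notin> set ds" by auto
    then show ?thesis using T2[OF i] col by auto
  qed
  have short: "?good (col i) \<longleftrightarrow> T1 ! i = 2" if i: "length T2 \<le> i" "i < length T1" for i
  proof -
    have "w \<noteq> []" using i by (auto simp: T1_def)
    moreover have "filter (\<lambda>r. i < length r) (insertion_tableau (bumped w)) = []"
      using length_rows[of _ "bumped w"] i(1) unfolding T2_def by (fastforce simp: filter_empty_conv)
    ultimately have "col i = [T1 ! i]"
      using i by (simp add: col_def insertion_tableau_rec T1_def)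
    then show ?thesis by simp
  qed
  have "(\<forall>c \<in> set (tableau_columns (insertion_tableau w)). ?good c) \<longleftrightarrow>
    (\<forall>i<length T1. ?good (col i))"
    unfolding set_tableau_columns col_def T1_def by blast
  also have "\<dots> \<longleftrightarrow> (\<forall>i<length T1. if i < length T2 then T1 ! i = 1 \<and> T2 ! i = 2 else T1 ! i = 2)"
    using long short by (metis not_less)
  also have "\<dots> \<longleftrightarrow> T1 = replicate (length T2) 1 @ replicate (length T1 - length T2) 2 \<and>
      T2 = replicate (length T2) 2"
    using le by (auto simp: list_eq_iff_nth_eq nth_append split: if_splits)
  finally show ?thesis .
qed

section \<open>Comparison of the two products row by row\<close>

theorem theorem3p5:
  fixes w :: "nat list"
  assumes "\<forall>x \<in> set w. 0 < x"
  shows "knuth_equiv ([2, 1, 2] @ w) (w @ [2, 1, 2]) \<longleftrightarrow>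
    (\<forall>c \<in> set (tableau_columns (insertion_tableau w)).
        (length c = 1 \<longrightarrow> c = [2]) \<and>
        (2 \<le> length c \<longrightarrow> 1 \<in> set c \<and> 2 \<in> set c))"
proof -
  define T1 T2 where "T1 = top_row w" and "T2 = top_row (bumped w)"
  have w1: "\<forall>x\<in>set w. 1 \<le> x" using assms by auto
  have o1: "\<forall>x\<in>set (bumped w). 2 \<le> x" using bumped_gt[OF w1] by auto
  have dom: "dominates T1 T2" unfolding T1_def T2_def by (rule dominates_top_row)
  have T1s: "sorted T1" "\<forall>x\<in>set T1. 1 \<le> x"
    using w1 set_top_row[of w] by (auto simp: T1_def sorted_top_row)
  obtain a s where s: "T1 = replicate a 1 @ s" "sorted s" "\<forall>x\<in>set s. Suc 1 \<le> x"
    by (rule sorted_split_least[OF T1s])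
  obtain b z where "s = replicate b (Suc 1) @ z" "sorted z" and z3: "\<forall>x\<in>set z. Suc (Suc 1) \<le> x"
    by (rule sorted_split_least[OF s(2,3)])
  then have T1: "T1 = replicate a 1 @ replicate b 2 @ z" and z: "\<forall>x\<in>set z. 3 \<le> x"
    and sorted_s: "sorted (replicate b 2 @ z)"
    using s by (simp_all add: numeral_2_eq_2 numeral_3_eq_3)
  have T2s: "sorted T2" "\<forall>x\<in>set T2. 2 \<le> x"
    using o1 set_top_row[of "bumped w"] by (auto simp: T2_def sorted_top_row)
  obtain c y where T2: "T2 = replicate c 2 @ y" and y3: "\<forall>x\<in>set y. Suc 2 \<le> x"
    by (rule sorted_split_least[OF T2s])
  then have y: "\<forall>x\<in>set y. 3 \<le> x" by simp
  have ca: "c \<le> a"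
  proof (rule ccontr)
    assume "\<not> c \<le> a"
    \<comment> \<open>Positions count from 0, so column \<open>a\<close> is the first one past the
      ones of \<open>T1\<close>; a 2 there would need a smaller entry above it.\<close>
    then have a: "a < length T2" "T2 ! a = 2"
      using T2 by (auto simp: nth_append)
    then have "a < length T1" "T1 ! a < 2"
      using dom by (auto simp: dominates_iff)
    moreover from this(1) have "T1 ! a \<in> set s"
      using s(1) by (auto simp: nth_append)
    ultimately show False using s(3) by fastforce
  qed
  have right: "insertion_tableau (w @ [2, 1, 2]) =
    (replicate (Suc a) 1 @ replicate (Suc b) 2 @ drop 2 z) #
    insertion_tableau (bumped w @ take 1 z @ [2] @ take 1 (drop 1 z))"
    using feed_212[OF z, of a b] T1
    by (subst insertion_tableau_rec) (simp_all add: top_row_append bumped_append T1_def)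
  \<comment> \<open>\<open>[1, 2] @ T2\<close> is the first row after reading 212 and
    \<open>bumped w\<close>, whose letters are all at least 2; \<open>f\<close> records how
    \<open>T1\<close> then enters it.\<close>
  define f where "f = feed ([1, 2] @ T2) T1"
  have "feed [] [2, 1, 2] = ([1, 2], [2])" by simp
  moreover have "feed [1, 2] (bumped w) = ([1, 2] @ T2, bumped (bumped w))"
    using feed_prefix[of "[1, 2]" "bumped w" "[]"] o1
    by (fastforce simp: T2_def top_row_def bumped_def)
  ultimately have "top_row ([2, 1, 2] @ bumped w @ T1) = fst f"
      and "bumped ([2, 1, 2] @ bumped w @ T1) = 2 # bumped (bumped w) @ snd f"
    unfolding top_row_def[of "_ @ _"] bumped_def[of "_ @ _"] f_def
    by (simp_all only: feed_append fst_conv snd_conv) simp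
  moreover have "insertion_tableau ([2, 1, 2] @ w) = insertion_tableau ([2, 1, 2] @ bumped w @ T1)"
    using plactic_append[OF plactic_bumped_top_row[of w], of "[2, 1, 2]" "[]"]
    by (simp add: insertion_tableau_plactic T1_def)
  ultimately have left: "insertion_tableau ([2, 1, 2] @ w) =
      fst f # insertion_tableau (2 # bumped (bumped w) @ snd f)"
    by (simp add: insertion_tableau_rec)
  have rhs: "(T1 = replicate (length T2) 1 @ replicate (length T1 - length T2) 2 \<and>
      T2 = replicate (length T2) 2) \<longleftrightarrow> c = a \<and> y = [] \<and> z = []" (is "?rhs \<longleftrightarrow> _")
  proof
    assume r: ?rhs
    then obtain n m where "T1 = replicate n 1 @ replicate m 2" "T2 = replicate n 2"
      by blast
    \<comment> \<open>Counting ones yields \<open>a\<close> from the decomposition of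
      \<open>T1\<close> and the length of \<open>T2\<close> from the assumed shape.\<close>
    then have "set T1 \<subseteq> {1, 2}" "set T2 \<subseteq> {2}" "length (filter ((=) 1) T1) = length T2"
      by (auto split: if_splits)
    moreover from this have "z = []" "y = []"
      using y z T1 T2 by (cases z; cases y; simp)+
    ultimately show "c = a \<and> y = [] \<and> z = []" by (simp add: T1 T2)
  qed (simp add: T1 T2)
  have "knuth_equiv ([2, 1, 2] @ w) (w @ [2, 1, 2]) \<longleftrightarrow> c = a \<and> y = [] \<and> z = []"
  proof (cases "c = a")
    case True
    \<comment> \<open>The row \<open>[1, 2] @ T2\<close> contains \<open>Suc a\<close> twos, so
      exactly one of them survives the \<open>a\<close> ones.\<close>
    have step1: "feed ([1, 2] @ T2) (replicate a 1) = (replicate (Suc a) 1 @ 2 # y, replicate a 2)"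
      using feed_replicate_12[of 1 a "2 # y"] T2 True
      by (simp add: replicate_app_Cons_same)
    \<comment> \<open>Removing the first \<open>a\<close> columns leaves \<open>y\<close> below the
      rest of \<open>T1\<close>, so that rest bumps exactly \<open>y\<close>.\<close>
    have "dominates (replicate k 1 @ X) (replicate k 2 @ Y) \<Longrightarrow> dominates X Y" for k X Y
      by (induction k) auto
    then have "dominates (replicate b 2 @ z) y"
      using dom T1 T2 True by blast
    then have step2: "feed ((replicate (Suc a) 1 @ [2]) @ y) (replicate b 2 @ z)
        = ((replicate (Suc a) 1 @ [2]) @ replicate b 2 @ z, y)"
      using sorted_s z by (intro feed_dominates) fastforce+
    have f: "f = (replicate (Suc a) 1 @ replicate (Suc b) 2 @ z, T2)"
      unfolding f_def T1 feed_append[of _ "replicate a 1"] step1 fst_conv snd_conv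
      using step2 T2 True by simp
    \<comment> \<open>The letters bumped out by \<open>T1\<close> form \<open>T2\<close>, which
      recombines with \<open>bumped (bumped w)\<close> to \<open>bumped w\<close>; the lower rows
      are then those of \<open>bumped w\<close> with a 2 in front.\<close>
    have "plactic (2 # bumped (bumped w) @ T2) (2 # bumped w)"
      using plactic_append[OF plactic_bumped_top_row[of "bumped w"], of "[2]" "[]"]
      by (simp add: T2_def plactic_sym)
    then have left': "insertion_tableau ([2, 1, 2] @ w) =
        (replicate (Suc a) 1 @ replicate (Suc b) 2 @ z) # (2 # T2) # insertion_tableau (bumped (bumped w))"
      using left f insertion_tableau_plactic insertion_tableau_Cons_least[OF o1]
      by (simp add: T2_def)
    have row2: "row_insert 2 T2 = (replicate (Suc c) 2 @ tl y, case y of [] \<Rightarrow> None | h # _ \<Rightarrow> Some h)"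
      using T2 y row_insert_append[of "replicate c 2" 2 y]
      by (cases y) (auto simp: replicate_app_Cons_same replicate_append_same)
    have top2: "top_row (bumped w @ [2]) = replicate (Suc c) 2 @ tl y"
      using row2 by (simp add: top_row_append T2_def[symmetric] split: list.splits option.splits prod.splits)
    have bump2: "bumped (bumped w @ [2]) = bumped (bumped w) @ take 1 y"
      using row2 by (cases y) (simp_all add: bumped_append T2_def[symmetric])
    have z_eq: "z = drop 2 z \<longleftrightarrow> z = []"
      by (cases z) (auto dest: arg_cong[where f = length])
    have y_eq: "y = tl y \<longleftrightarrow> y = []"
      by (cases y) auto
    have right': "insertion_tableau (w @ [2, 1, 2]) =
        (replicate (Suc a) 1 @ replicate (Suc b) 2) # (replicate (Suc c) 2 @ tl y) #
        insertion_tableau (bumped (bumped w) @ take 1 y)" if "z = []"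
      using right that insertion_tableau_rec[of "bumped w @ [2]"] top2 bump2 by simp
    show ?thesis
    \<comment> \<open>A nonempty \<open>z\<close> already separates the first rows. If
      \<open>z\<close> is empty, the second rows differ by the first letter of \<open>y\<close>; if
      \<open>y\<close> is empty too, nothing is bumped into the third row.\<close>
    proof (cases "z = []")
      case zNil: True
      then show ?thesis
        using left' right' True T2 y_eq by (auto simp: knuth_equiv_def)
    next
      case False
      then show ?thesis using left' right z_eq by (auto simp: knuth_equiv_def)
    qed
  next
    case False
    define n where "n = a - Suc c"
    have a: "a = Suc c + n" using ca False by (simp add: n_def)
    have notin: "2 \<notin> set y" "2 \<notin> set z" using y z by auto
    \<comment> \<open>Since \<open>c < a\<close>, \<open>T1\<close> starts with at least
      \<open>Suc c\<close> ones, enough to bump every 2 of \<open>[1, 2] @ T2\<close>. Only the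
      \<open>b\<close> twos of \<open>T1\<close> can then occur in the final first row.\<close>
    have "feed ([1, 2] @ T2) (replicate (Suc c) 1) = (replicate (Suc (Suc c)) 1 @ y, replicate (Suc c) 2)"
      using feed_replicate_12[of 1 "Suc c" y] T2 by simp
    then have "fst f = fst (feed (replicate (Suc (Suc c)) 1 @ y) (replicate n 1 @ replicate b 2 @ z))"
      by (simp only: f_def T1 a replicate_add append_assoc feed_append[of _ "replicate (Suc c) 1"]) simp
    moreover have count: "count_list (replicate k x) (2::nat) = (if x = 2 then k else 0)" for k x
      by (induction k) auto
    ultimately have "count_list (fst f) 2 \<le> b"
      using notin count_list_feed[of "replicate (Suc (Suc c)) 1 @ y" "replicate n 1 @ replicate b 2 @ z" 2]
      by simp
    moreover have "count_list (replicate (Suc a) 1 @ replicate (Suc b) 2 @ drop 2 z) 2 \<ge> Suc b"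
      by (simp add: count)
    ultimately have "fst f \<noteq> replicate (Suc a) 1 @ replicate (Suc b) 2 @ drop 2 z"
      by (metis Suc_n_not_le_n order_trans)
    then show ?thesis using left right False by (simp add: knuth_equiv_def)
  qed
  then show ?thesis
    using columns_iff[OF assms] rhs by (simp add: T1_def T2_def)
qed

end
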